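(* Let $\mathcal{A}$ be a finite algebra (with finite signature) with universe $A$. Suppose that $\mathcal{A}$ is automorphism-primal and that $\mathrm{Fix}(\mathcal{A})$ has at least two elements. Then $$\mathrm{PSpec}(\mathcal{A})=\bigcup_{k\geq 1}\left\{\frac{1}{|A|^k}\sum_{C\in I}|C| \;\middle|\; I\subseteq A^k/\mathrm{Aut}(\mathcal{A})\right\},$$ where $A^k/\mathrm{Aut}(\mathcal{A})$ is the set of orbits of the componentwise action of $\mathrm{Aut}(\mathcal{A})$ on $A^k$ (the empty sum being $0$).
   Context: All algebras are (nonempty) algebras in the sense of universal algebra, finite and with a finite signature. A term is an element of the absolutely free algebra over an infinite set of variables; a term with $k$ variables is interpreted in $\mathcal{A}$ as a function $A^k\to A$. An equation $t\approx t'$ is an ordered pair of terms in the signature; its number of variables $k$ is the total number of distinct variables appearing in it. The probability of the equation over $\mathcal{A}$ is $$\Pr(t\approx t'\mid\mathcal{A})=\frac{|\{\vec{x}\in A^k\mid t(\vec{x})=t'(\vec{x})\}|}{|A|^k}.$$ The equational probabilistic spectrum is $\mathrm{PSpec}(\mathcal{A})=\{\Pr(t\approx t'\mid\mathcal{A})\mid t\approx t' \text{ an equation in the signature of }\mathcal{A}\}$. $\mathrm{Clo}(\mathcal{A})$ is the clone generated by the operations of $\mathcal{A}$ (the term functions). The automorphism group $\mathrm{Aut}(\mathcal{A})$ acts on $A^k$ by $\varphi\cdot(x_1,\ldots,x_k)=(\varphi(x_1),\ldots,\varphi(x_k))$. $\mathcal{A}$ is automorphism-primal if every function $f:A^k\to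 A$ ($k\ge 1$) satisfying $f(\varphi\cdot\vec{x})=\varphi(f(\vec{x}))$ for all $\varphi\in\mathrm{Aut}(\mathcal{A})$ and $\vec{x}\in A^k$ belongs to $\mathrm{Clo}(\mathcal{A})$. Finally, $\mathrm{Fix}(\mathcal{A})=\{x\in A\mid \varphi(x)=x \text{ for all }\varphi\in\mathrm{Aut}(\mathcal{A})\}$. *)

theory Defs
  imports Complex_Main "HOL-Algebra.Group_Action"
begin

section \<open>Finite algebras over a finite signature\<close>

record ('f, 'a) algebra = "'a partial_object" +
  symbols :: "'f set"
  arity :: "'f \<Rightarrow> nat"
  interp :: "'f \<Rightarrow> 'a list \<Rightarrow> 'a"

text \<open>The power \<open>A\<^sup>k\<close> is represented by the lists of length \<open>k\<close> with entries in \<open>A\<close>.\<close>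

definition tuples :: "'a set \<Rightarrow> nat \<Rightarrow> 'a list set" where
  "tuples A k = {xs. set xs \<subseteq> A \<and> length xs = k}"

text \<open>Symbols of arity 0 (constants) are allowed.\<close>

definition finite_algebra :: "('f, 'a) algebra \<Rightarrow> bool" where
  "finite_algebra \<A> \<longleftrightarrow>
     finite (carrier \<A>) \<and> carrier \<A> \<noteq> {} \<and> finite (symbols \<A>) \<and>
     (\<forall>f\<in>symbols \<A>. \<forall>xs\<in>tuples (carrier \<A>) (arity \<A> f). interp \<A> f xs \<in> carrier \<A>)"

section \<open>Terms and equations\<close>

datatype 'f trm = Var nat | App 'f "'f trm list"

fun vars :: "'f trm \<Rightarrow> nat set" where
  "vars (Var i) = {i}"
| "vars (App f ts) = (\<Union>t\<in>set ts. vars t)"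

fun is_term :: "('f, 'a) algebra \<Rightarrow> 'f trm \<Rightarrow> bool" where
  "is_term \<A> (Var i) \<longleftrightarrow> True"
| "is_term \<A> (App f ts) \<longleftrightarrow>
     f \<in> symbols \<A> \<and> length ts = arity \<A> f \<and> (\<forall>t\<in>set ts. is_term \<A> t)"

fun term_value :: "('f, 'a) algebra \<Rightarrow> (nat \<Rightarrow> 'a) \<Rightarrow> 'f trm \<Rightarrow> 'a" where
  "term_value \<A> x (Var i) = x i"
| "term_value \<A> x (App f ts) = interp \<A> f (map (term_value \<A> x) ts)"

text \<open>
  If \<open>V\<close> is the set of the \<open>k\<close> variables that appear in \<open>t \<approx> t'\<close>, then \<open>A\<^sup>k\<close> is the set of
  assignments \<open>V \<rightarrow>\<^sub>E A\<close>, so that no order on the variables has to be chosen.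
\<close>

definition eq_prob :: "('f, 'a) algebra \<Rightarrow> 'f trm \<Rightarrow> 'f trm \<Rightarrow> real" where
  "eq_prob \<A> t t' =
     real (card {x \<in> (vars t \<union> vars t') \<rightarrow>\<^sub>E carrier \<A>. term_value \<A> x t = term_value \<A> x t'})
       / real (card (carrier \<A>)) ^ card (vars t \<union> vars t')"

definition PSpec :: "('f, 'a) algebra \<Rightarrow> real set" where
  "PSpec \<A> = {eq_prob \<A> t t' | t t'. is_term \<A> t \<and> is_term \<A> t'}"

section \<open>Term functions, automorphisms, automorphism-primality\<close>

text \<open>The \<open>k\<close>-ary part of the clone; functions on \<open>A\<^sup>k\<close> are extensional.\<close>

definition Clo :: "('f, 'a) algebra \<Rightarrow> nat \<Rightarrow> ('a list \<Rightarrow> 'a) set" where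
  "Clo \<A> k =
     {\<lambda>xs\<in>tuples (carrier \<A>) k. term_value \<A> (\<lambda>i. xs ! i) t | t.
        is_term \<A> t \<and> vars t \<subseteq> {..<k}}"

definition Aut :: "('f, 'a) algebra \<Rightarrow> ('a \<Rightarrow> 'a) set" where
  "Aut \<A> = {\<phi> \<in> Bij (carrier \<A>).
     \<forall>f\<in>symbols \<A>. \<forall>xs\<in>tuples (carrier \<A>) (arity \<A> f).
       \<phi> (interp \<A> f xs) = interp \<A> f (map \<phi> xs)}"

definition Aut_group :: "('f, 'a) algebra \<Rightarrow> ('a \<Rightarrow> 'a) monoid" where
  "Aut_group \<A> = BijGroup (carrier \<A>) \<lparr>carrier := Aut \<A>\<rparr>"

definition tuple_action :: "('f, 'a) algebra \<Rightarrow> nat \<Rightarrow> ('a \<Rightarrow> 'a) \<Rightarrow> 'a list \<Rightarrow> 'a list" where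
  "tuple_action \<A> k \<phi> = (\<lambda>xs\<in>tuples (carrier \<A>) k. map \<phi> xs)"

definition tuple_orbits :: "('f, 'a) algebra \<Rightarrow> nat \<Rightarrow> 'a list set set" where
  "tuple_orbits \<A> k = orbits (Aut_group \<A>) (tuples (carrier \<A>) k) (tuple_action \<A> k)"

definition automorphism_primal :: "('f, 'a) algebra \<Rightarrow> bool" where
  "automorphism_primal \<A> \<longleftrightarrow>
     (\<forall>k\<ge>1. \<forall>f \<in> tuples (carrier \<A>) k \<rightarrow>\<^sub>E carrier \<A>.
        (\<forall>\<phi>\<in>Aut \<A>. \<forall>xs\<in>tuples (carrier \<A>) k. f (tuple_action \<A> k \<phi> xs) = \<phi> (f xs))
        \<longrightarrow> f \<in> Clo \<A> k)"

definition Fix :: "('f, 'a) algebra \<Rightarrow> 'a set" where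
  "Fix \<A> = {x \<in> carrier \<A>. \<forall>\<phi>\<in>Aut \<A>. \<phi> x = x}"

lemma tuples_map: "\<phi> \<in> A \<rightarrow> A \<Longrightarrow> xs \<in> tuples A k \<Longrightarrow> map \<phi> xs \<in> tuples A k"
  by (auto simp: tuples_def)

lemma subgroup_Aut:
  assumes "finite_algebra \<A>"
  shows "subgroup (Aut \<A>) (BijGroup (carrier \<A>))"
proof -
  let ?A = "carrier \<A>"
  interpret B: group "BijGroup ?A" by (rule group_BijGroup)
  have clo: "interp \<A> f xs \<in> ?A" if "f \<in> symbols \<A>" "xs \<in> tuples ?A (arity \<A> f)" for f xs
    using assms that by (auto simp: finite_algebra_def)
  show ?thesis
  proof (rule B.subgroupI)
    show "Aut \<A> \<subseteq> carrier (BijGroup ?A)"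
      by (auto simp: Aut_def BijGroup_def)
    have "(\<lambda>x\<in>?A. x) \<in> Aut \<A>"
    proof -
      have "map (\<lambda>x\<in>?A. x) xs = xs" if "xs \<in> tuples ?A k" for xs k
        using that by (auto simp: tuples_def intro!: map_idI)
      then show ?thesis
        by (auto simp: Aut_def id_Bij clo)
    qed
    then show "Aut \<A> \<noteq> {}" by blast
  next
    fix a assume a: "a \<in> Aut \<A>"
    then have aB: "a \<in> Bij ?A" by (simp add: Aut_def)
    let ?b = "restrict (inv_into ?A a) ?A"
    have bB: "?b \<in> Bij ?A" by (rule restrict_inv_into_Bij[OF aB])
    have "?b (interp \<A> f xs) = interp \<A> f (map ?b xs)"
      if f: "f \<in> symbols \<A>" and xs: "xs \<in> tuples ?A (arity \<A> f)" for f xs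
    proof -
      have bij: "bij_betw a ?A ?A" using aB by (simp add: Bij_def)
      have ys: "map ?b xs \<in> tuples ?A (arity \<A> f)"
        by (rule tuples_map[OF Bij_imp_funcset[OF bB] xs])
      have "map a (map ?b xs) = xs"
        using xs bij by (auto simp: tuples_def bij_betw_inv_into_right intro!: map_idI)
      then have "a (interp \<A> f (map ?b xs)) = interp \<A> f xs"
        using a f ys by (simp add: Aut_def)
      then show ?thesis
        using clo[OF f ys] clo[OF f xs] bij_betw_inv_into_left[OF bij]
        by (metis restrict_apply')
    qed
    then show "inv\<^bsub>BijGroup ?A\<^esub> a \<in> Aut \<A>"
      using bB by (simp add: inv_BijGroup[OF aB] Aut_def del: restrict_apply)
  next
    fix a b assume a: "a \<in> Aut \<A>" and b: "b \<in> Aut \<A>"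
    then have aB: "a \<in> Bij ?A" and bB: "b \<in> Bij ?A" by (simp_all add: Aut_def)
    have "compose ?A a b (interp \<A> f xs) = interp \<A> f (map (compose ?A a b) xs)"
      if f: "f \<in> symbols \<A>" and xs: "xs \<in> tuples ?A (arity \<A> f)" for f xs
    proof -
      have "map (compose ?A a b) xs = map a (map b xs)"
        using xs by (auto simp: tuples_def compose_def)
      moreover have bxs: "map b xs \<in> tuples ?A (arity \<A> f)"
        by (rule tuples_map[OF Bij_imp_funcset[OF bB] xs])
      moreover have "compose ?A a b (interp \<A> f xs) = a (b (interp \<A> f xs))"
        using clo[OF f xs] by (simp add: compose_def)
      moreover have "b (interp \<A> f xs) = interp \<A> f (map b xs)"
        using b f xs by (simp add: Aut_def)
      moreover have "a (interp \<A> f (map b xs)) = interp \<A> f (map a (map b xs))"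
        using a f bxs unfolding Aut_def by blast
      ultimately show ?thesis by (simp only:)
    qed
    then show "a \<otimes>\<^bsub>BijGroup ?A\<^esub> b \<in> Aut \<A>"
      using aB bB by (simp add: BijGroup_def Aut_def compose_Bij)
  qed
qed

lemma tuple_action_Bij:
  assumes "\<phi> \<in> Bij (carrier \<A>)"
  shows "tuple_action \<A> k \<phi> \<in> Bij (tuples (carrier \<A>) k)"
proof -
  let ?A = "carrier \<A>"
  let ?T = "tuples ?A k"
  have bij: "bij_betw \<phi> ?A ?A" using assms by (simp add: Bij_def)
  have "bij_betw (map \<phi>) ?T ?T"
  proof (rule bij_betw_byWitness[where f' = "map (inv_into ?A \<phi>)"])
    show "\<forall>xs\<in>?T. map (inv_into ?A \<phi>) (map \<phi> xs) = xs"
      using bij by (auto simp: tuples_def bij_betw_inv_into_left intro!: map_idI)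
    show "\<forall>xs\<in>?T. map \<phi> (map (inv_into ?A \<phi>) xs) = xs"
      using bij by (auto simp: tuples_def bij_betw_inv_into_right intro!: map_idI)
    show "map \<phi> ` ?T \<subseteq> ?T"
      using tuples_map[OF Bij_imp_funcset[OF assms]] by blast
    have "inv_into ?A \<phi> \<in> ?A \<rightarrow> ?A"
      using Bij_inv_into_mem[OF assms] by blast
    then show "map (inv_into ?A \<phi>) ` ?T \<subseteq> ?T"
      using tuples_map by blast
  qed
  then show ?thesis by (simp add: Bij_def tuple_action_def)
qed

lemma group_action_tuples:
  assumes "finite_algebra \<A>"
  shows "group_action (Aut_group \<A>) (tuples (carrier \<A>) k) (tuple_action \<A> k)"
proof -
  let ?A = "carrier \<A>"
  let ?T = "tuples ?A k"
  have G: "group (Aut_group \<A>)"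
    unfolding Aut_group_def
    by (rule subgroup.subgroup_is_group[OF subgroup_Aut[OF assms] group_BijGroup])
  have AB: "\<phi> \<in> Bij ?A" if "\<phi> \<in> Aut \<A>" for \<phi>
    using that by (simp add: Aut_def)
  have "tuple_action \<A> k (compose ?A a b) = compose ?T (tuple_action \<A> k a) (tuple_action \<A> k b)"
    if "a \<in> Aut \<A>" "b \<in> Aut \<A>" for a b
  proof
    fix xs
    show "tuple_action \<A> k (compose ?A a b) xs
        = compose ?T (tuple_action \<A> k a) (tuple_action \<A> k b) xs"
      using tuples_map[OF Bij_imp_funcset[OF AB[OF that(2)]], of xs k]
      by (auto simp: tuple_action_def compose_def tuples_def)
  qed
  then have "tuple_action \<A> k \<in> hom (Aut_group \<A>) (BijGroup ?T)"
    by (auto simp: hom_def Aut_group_def BijGroup_def AB tuple_action_Bij)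
  then show ?thesis
    using G group_BijGroup
    by (simp add: group_action_def group_hom_def group_hom_axioms_def)
qed

end

theory Submission
  imports Defs
begin

text \<open>
  Both sides of the equation list the relative sizes of the \<open>Aut \<A>\<close>-invariant subsets of the powers
  of \<open>A\<close>: an invariant subset is the same thing as a union of orbits, and orbits are disjoint, so
  the size of the union is the sum of their sizes.

  The solution set of an equation is invariant because automorphisms commute with term functions.
  Conversely, let \<open>S \<subseteq> A\<^sup>k\<close> be invariant and let \<open>a \<noteq> b\<close> be fixed points of \<open>Aut \<A>\<close>. The constant
  function \<open>a\<close> and the function that is \<open>a\<close> on \<open>S\<close> and \<open>b\<close> off \<open>S\<close> are both equivariant, so
  automorphism-primality turns them into terms \<open>t\<close> and \<open>t'\<close>; the solution set of \<open>t \<approx> t'\<close> is \<open>S\<close>.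

  The one point of friction is the number of variables. The terms that automorphism-primality
  yields need not contain all of the \<open>k\<close> variables, the variables of a given equation need not be
  an initial segment of the naturals, and an equation between ground terms has none, while
  the right-hand side starts at \<open>k = 1\<close>. All of this is settled by \<open>eq_prob_tuples\<close>:
  dummy variables do not change the probability of an equation.
\<close>

section \<open>Term functions and automorphisms\<close>

lemma term_value_cong:
  "(\<And>i. i \<in> vars t \<Longrightarrow> x i = y i) \<Longrightarrow> term_value \<A> x t = term_value \<A> y t"
proof (induction t)
  case (App f ts)
  then have "map (term_value \<A> x) ts = map (term_value \<A> y) ts" by auto
  then show ?case by (simp only: term_value.simps)
qed simp

lemma finite_vars: "finite (vars t)"
  by (induction t) auto

lemma term_value_closed:
  assumes "finite_algebra \<A>" "is_term \<A> t" "\<And>i. i \<in> vars t \<Longrightarrow> x i \<in> carrier \<A>"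
  shows "term_value \<A> x t \<in> carrier \<A>"
  using assms(2,3)
proof (induction t)
  case (App f ts)
  then have "map (term_value \<A> x) ts \<in> tuples (carrier \<A>) (arity \<A> f)"
    by (auto simp: tuples_def)
  then show ?case using assms(1) App.prems by (simp add: finite_algebra_def)
qed simp

lemma Aut_term_value:
  assumes "finite_algebra \<A>" "\<phi> \<in> Aut \<A>" "is_term \<A> t" "\<And>i. i \<in> vars t \<Longrightarrow> x i \<in> carrier \<A>"
  shows "\<phi> (term_value \<A> x t) = term_value \<A> (\<lambda>i. \<phi> (x i)) t"
  using assms(3,4)
proof (induction t)
  case (App f ts)
  then have eq: "map \<phi> (map (term_value \<A> x) ts) = map (term_value \<A> (\<lambda>i. \<phi> (x i))) ts"
    by auto
  have "map (term_value \<A> x) ts \<in> tuples (carrier \<A>) (arity \<A> f)"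
    using App.prems term_value_closed[OF assms(1)] by (fastforce simp: tuples_def)
  moreover have "f \<in> symbols \<A>" using App.prems by simp
  ultimately have "\<phi> (interp \<A> f (map (term_value \<A> x) ts))
      = interp \<A> f (map \<phi> (map (term_value \<A> x) ts))"
    using assms(2) unfolding Aut_def by blast
  then show ?case by (simp only: term_value.simps eq)
qed simp

section \<open>Dummy variables\<close>

lemma finite_tuples: "finite A \<Longrightarrow> finite (tuples A n)"
  unfolding tuples_def by (rule finite_lists_length_eq)

lemma bij_betw_tuples_PiE:
  "bij_betw (\<lambda>xs. \<lambda>i\<in>{..<n}. xs ! i) (tuples A n) ({..<n} \<rightarrow>\<^sub>E A)"
proof (rule bij_betw_byWitness[where f' = "\<lambda>x. map x [0..<n]"])
  show "\<forall>xs\<in>tuples A n. map (\<lambda>i\<in>{..<n}. xs ! i) [0..<n] = xs"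
    by (intro ballI nth_equalityI) (simp_all add: tuples_def)
  show "\<forall>x\<in>{..<n} \<rightarrow>\<^sub>E A. (\<lambda>i\<in>{..<n}. map x [0..<n] ! i) = x"
  proof
    fix x assume "x \<in> {..<n} \<rightarrow>\<^sub>E A"
    then have "restrict x {..<n} = x" by (rule PiE_restrict)
    moreover have "(\<lambda>i\<in>{..<n}. map x [0..<n] ! i) = restrict x {..<n}"
      by (rule restrict_ext) simp
    ultimately show "(\<lambda>i\<in>{..<n}. map x [0..<n] ! i) = x" by simp
  qed
  show "(\<lambda>xs. \<lambda>i\<in>{..<n}. xs ! i) ` tuples A n \<subseteq> {..<n} \<rightarrow>\<^sub>E A"
    by (intro image_subsetI restrict_PiE_iff[THEN iffD2] ballI) (force simp: tuples_def)
  show "(\<lambda>x. map x [0..<n]) ` ({..<n} \<rightarrow>\<^sub>E A) \<subseteq> tuples A n"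
    by (intro image_subsetI) (simp add: tuples_def PiE_iff image_subset_iff)
qed

text \<open>
  A condition on the coordinates in \<open>V\<close> alone cuts out a cylinder: each assignment on \<open>V\<close> extends
  to \<open>W\<close> in \<open>\<bar>A\<bar>\<close> ways for each coordinate of \<open>W - V\<close>.
\<close>

lemma card_cylinder:
  assumes "finite A" "finite W" "V \<subseteq> W" "S \<subseteq> V \<rightarrow>\<^sub>E A"
  shows "card {x \<in> W \<rightarrow>\<^sub>E A. restrict x V \<in> S} = card S * card A ^ card (W - V)"
proof -
  let ?F = "\<lambda>y. Pi\<^sub>E W (\<lambda>i. if i \<in> V then {y i} else A)"
  have "finite V" by (rule finite_subset[OF assms(3,2)])
  then have finS: "finite S"
    using assms(1,4) by (meson finite_PiE finite_subset)
  have fibre: "?F y = {x \<in> W \<rightarrow>\<^sub>E A. restrict x V = y}" if "y \<in> S" for y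
  proof -
    have y: "y \<in> V \<rightarrow>\<^sub>E A" using that assms(4) by blast
    then have restr: "restrict x V = y \<longleftrightarrow> (\<forall>i\<in>V. x i = y i)" for x
      by (metis PiE_restrict restrict_apply' restrict_ext)
    have coords: "(\<forall>i\<in>W. x i \<in> (if i \<in> V then {y i} else A)) \<longleftrightarrow>
        (\<forall>i\<in>W. x i \<in> A) \<and> (\<forall>i\<in>V. x i = y i)" for x
      using PiE_mem[OF y] assms(3) by (auto simp: subset_iff)
    show ?thesis
      by (rule Set.set_eqI) (simp add: PiE_iff restr coords conj_ac)
  qed
  have "card (?F y) = card A ^ card (W - V)" for y
  proof -
    have "card (?F y) = (\<Prod>i\<in>W. if i \<in> V then 1 else card A)"
      using assms(2) by (simp add: card_PiE if_distrib cong: if_cong)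
    also have "\<dots> = (\<Prod>i\<in>W - V. card A)"
      by (rule prod.mono_neutral_cong_right) (use assms(2) in auto)
    finally show ?thesis by simp
  qed
  moreover have "{x \<in> W \<rightarrow>\<^sub>E A. restrict x V \<in> S} = (\<Union>y\<in>S. ?F y)"
    using fibre by auto
  moreover have "card (\<Union>y\<in>S. ?F y) = (\<Sum>y\<in>S. card (?F y))"
  proof (rule card_UN_disjoint[OF finS])
    show "\<forall>y\<in>S. finite (?F y)" using assms(1,2) by (auto intro!: finite_PiE)
    show "\<forall>y\<in>S. \<forall>z\<in>S. y \<noteq> z \<longrightarrow> ?F y \<inter> ?F z = {}" using fibre by auto
  qed
  ultimately show ?thesis by simp
qed

definition solutions :: "('f, 'a) algebra \<Rightarrow> nat \<Rightarrow> 'f trm \<Rightarrow> 'f trm \<Rightarrow> 'a list set" where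
  "solutions \<A> n t t' =
     {xs \<in> tuples (carrier \<A>) n. term_value \<A> (\<lambda>i. xs ! i) t = term_value \<A> (\<lambda>i. xs ! i) t'}"

text \<open>
  The solution set in \<open>A\<^sup>n\<close> is the cylinder over the solution set in the variables that occur, and
  the factors \<open>\<bar>A\<bar>\<close> contributed by the dummy variables cancel.
\<close>

lemma eq_prob_tuples:
  assumes "finite_algebra \<A>" "vars t \<union> vars t' \<subseteq> {..<n}"
  shows "eq_prob \<A> t t' = real (card (solutions \<A> n t t')) / real (card (carrier \<A>)) ^ n"
proof -
  let ?A = "carrier \<A>" and ?V = "vars t \<union> vars t'"
  define S where "S = {x \<in> ?V \<rightarrow>\<^sub>E ?A. term_value \<A> x t = term_value \<A> x t'}"
  have finA: "finite ?A" and A0: "card ?A > 0"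
    using assms(1) by (auto simp: finite_algebra_def card_gt_0_iff)
  let ?h = "\<lambda>xs. \<lambda>i\<in>{..<n}. xs ! i"
  have eq: "term_value \<A> (\<lambda>i. xs ! i) s = term_value \<A> (restrict (?h xs) ?V) s"
    if "s \<in> {t, t'}" for xs s
    by (rule term_value_cong) (use that assms(2) in auto)
  have memS: "restrict (?h xs) ?V \<in> S \<longleftrightarrow> xs \<in> solutions \<A> n t t'"
    if "xs \<in> tuples ?A n" for xs
  proof -
    have "restrict (?h xs) ?V \<in> ?V \<rightarrow>\<^sub>E ?A"
    proof (rule restrict_PiE_iff[THEN iffD2], intro ballI)
      fix i assume "i \<in> ?V"
      then have "i < n" using assms(2) by blast
      then show "?h xs i \<in> ?A" using that by (auto simp: tuples_def)
    qed
    then show ?thesis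
      using that by (simp add: S_def solutions_def eq)
  qed
  have "bij_betw ?h (solutions \<A> n t t') {x \<in> {..<n} \<rightarrow>\<^sub>E ?A. restrict x ?V \<in> S}"
  proof (rule bij_betw_subset[OF bij_betw_tuples_PiE])
    show "solutions \<A> n t t' \<subseteq> tuples ?A n" by (auto simp: solutions_def)
    have img: "?h ` tuples ?A n = {..<n} \<rightarrow>\<^sub>E ?A"
      using bij_betw_tuples_PiE by (rule bij_betw_imp_surj_on)
    have "{x \<in> {..<n} \<rightarrow>\<^sub>E ?A. restrict x ?V \<in> S}
        = ?h ` {xs \<in> tuples ?A n. restrict (?h xs) ?V \<in> S}"
      unfolding img[symmetric] by (rule Compr_image_eq)
    also have "{xs \<in> tuples ?A n. restrict (?h xs) ?V \<in> S} = solutions \<A> n t t'"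
      using memS by (auto simp: solutions_def)
    finally show "?h ` solutions \<A> n t t' = {x \<in> {..<n} \<rightarrow>\<^sub>E ?A. restrict x ?V \<in> S}" ..
  qed
  then have "card (solutions \<A> n t t') = card {x \<in> {..<n} \<rightarrow>\<^sub>E ?A. restrict x ?V \<in> S}"
    by (rule bij_betw_same_card)
  also have "\<dots> = card S * card ?A ^ card ({..<n} - ?V)"
    by (rule card_cylinder) (use finA assms(2) in \<open>auto simp: S_def\<close>)
  finally have "card (solutions \<A> n t t') = card S * card ?A ^ (n - card ?V)"
    using assms(2) by (simp add: card_Diff_subset finite_vars)
  then have "real (card (solutions \<A> n t t')) = real (card S) * real (card ?A) ^ (n - card ?V)"
    by simp
  moreover have "real (card ?A) ^ n = real (card ?A) ^ (n - card ?V) * real (card ?A) ^ card ?V"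
    using card_mono[OF _ assms(2)] by (simp add: power_add[symmetric])
  ultimately show ?thesis
    using A0 by (simp add: eq_prob_def S_def[symmetric])
qed

section \<open>Invariant sets and unions of orbits\<close>

lemma (in group_action) orbit_in_orbits: "x \<in> E \<Longrightarrow> orbit G \<phi> x \<in> orbits G E \<phi>"
  by (auto simp: orbits_def)

lemma (in group_action) mem_Union_orbits_iff:
  assumes "I \<subseteq> orbits G E \<phi>" "g \<in> carrier G" "x \<in> E"
  shows "\<phi> g x \<in> \<Union>I \<longleftrightarrow> x \<in> \<Union>I"
proof -
  have "\<phi> g x \<in> orbit G \<phi> x" using assms(2) by (auto simp: orbit_def)
  moreover have "x \<in> orbit G \<phi> x" by (rule orbit_refl[OF assms(3)])
  \<comment> \<open>A member of \<open>I\<close> containing \<open>x\<close> or \<open>\<phi> g x\<close> meets the orbit of \<open>x\<close>, so it is that orbit.\<close>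
  ultimately have "C = orbit G \<phi> x" if "C \<in> I" "x \<in> C \<or> \<phi> g x \<in> C" for C
    using that assms(1) disjoint_union[OF _ orbit_in_orbits[OF assms(3)], of C] by blast
  then show ?thesis
    using \<open>\<phi> g x \<in> orbit G \<phi> x\<close> \<open>x \<in> orbit G \<phi> x\<close> by blast
qed

lemma (in group_action) card_Union_orbits:
  assumes "finite E" "I \<subseteq> orbits G E \<phi>"
  shows "card (\<Union>I) = (\<Sum>C\<in>I. card C)"
proof (rule card_Union_disjoint)
  show "pairwise disjnt I"
    using assms(2) disjoint_union by (fastforce simp: pairwise_def disjnt_def)
  fix C assume "C \<in> I"
  then have "C \<subseteq> E" using assms(2) orbits_coverture by blast
  then show "finite C" using assms(1) finite_subset by blast
qed

lemma (in group_action) invariant_Union_orbits: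
  assumes "S \<subseteq> E" "\<And>g x. g \<in> carrier G \<Longrightarrow> x \<in> S \<Longrightarrow> \<phi> g x \<in> S"
  obtains I where "I \<subseteq> orbits G E \<phi>" "\<Union>I = S"
proof
  show "orbit G \<phi> ` S \<subseteq> orbits G E \<phi>"
    using assms(1) orbit_in_orbits by blast
  show "\<Union> (orbit G \<phi> ` S) = S"
    using assms orbit_refl by (fastforce simp: orbit_def)
qed

section \<open>Invariant sets and solution sets\<close>

lemma solutions_invariant:
  assumes "finite_algebra \<A>" "is_term \<A> t" "is_term \<A> t'" "vars t \<union> vars t' \<subseteq> {..<n}"
    and \<phi>: "\<phi> \<in> Aut \<A>" and xs: "xs \<in> solutions \<A> n t t'"
  shows "tuple_action \<A> n \<phi> xs \<in> solutions \<A> n t t'"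
proof -
  have xsT: "xs \<in> tuples (carrier \<A>) n" using xs by (simp add: solutions_def)
  have eq: "term_value \<A> (\<lambda>i. map \<phi> xs ! i) s = \<phi> (term_value \<A> (\<lambda>i. xs ! i) s)"
    if s: "is_term \<A> s" "vars s \<subseteq> {..<n}" for s
  proof -
    have "term_value \<A> (\<lambda>i. map \<phi> xs ! i) s = term_value \<A> (\<lambda>i. \<phi> (xs ! i)) s"
      by (rule term_value_cong) (use s xsT in \<open>auto simp: tuples_def\<close>)
    also have "\<dots> = \<phi> (term_value \<A> (\<lambda>i. xs ! i) s)"
      by (rule Aut_term_value[symmetric, OF assms(1) \<phi>])
        (use s xsT in \<open>auto simp: tuples_def subset_iff\<close>)
    finally show ?thesis .
  qed
  have "\<phi> \<in> carrier \<A> \<rightarrow> carrier \<A>"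
    using \<phi> by (auto simp: Aut_def intro: Bij_imp_funcset[THEN funcset_mem])
  then have "map \<phi> xs \<in> tuples (carrier \<A>) n" using xsT by (rule tuples_map)
  then show ?thesis
    using assms(2-4) xs by (simp add: solutions_def tuple_action_def eq)
qed

text \<open>
  Two distinct fixed points serve as truth values: the indicator function of an invariant set with
  these values is equivariant, hence a term function.
\<close>

lemma automorphism_primal_solutions:
  assumes "automorphism_primal \<A>" "card (Fix \<A>) \<ge> 2" "k \<ge> 1"
    and S: "S \<subseteq> tuples (carrier \<A>) k"
    and inv: "\<And>\<phi> xs. \<phi> \<in> Aut \<A> \<Longrightarrow> xs \<in> tuples (carrier \<A>) k \<Longrightarrow>
      tuple_action \<A> k \<phi> xs \<in> S \<longleftrightarrow> xs \<in> S"
  obtains t t' where "is_term \<A> t" "is_term \<A> t'" "vars t \<union> vars t' \<subseteq> {..<k}"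
    "solutions \<A> k t t' = S"
proof -
  let ?T = "tuples (carrier \<A>) k"
  obtain a b where ab: "a \<in> Fix \<A>" "b \<in> Fix \<A>" "a \<noteq> b"
    using assms(2) by (auto simp: numeral_2_eq_2 card_le_Suc_iff)
  then have abA: "a \<in> carrier \<A>" "b \<in> carrier \<A>"
    and fixed: "\<phi> \<in> Aut \<A> \<Longrightarrow> \<phi> a = a" "\<phi> \<in> Aut \<A> \<Longrightarrow> \<phi> b = b" for \<phi>
    by (auto simp: Fix_def)
  have ind: "(\<lambda>xs\<in>?T. if xs \<in> R then a else b) \<in> Clo \<A> k"
    if R: "\<And>\<phi> xs. \<phi> \<in> Aut \<A> \<Longrightarrow> xs \<in> ?T \<Longrightarrow> tuple_action \<A> k \<phi> xs \<in> R \<longleftrightarrow> xs \<in> R" for R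
  proof -
    let ?f = "\<lambda>xs\<in>?T. if xs \<in> R then a else b"
    have "?f (tuple_action \<A> k \<phi> xs) = \<phi> (?f xs)" if \<phi>: "\<phi> \<in> Aut \<A>" and xs: "xs \<in> ?T" for \<phi> xs
    proof -
      have "\<phi> \<in> Bij (carrier \<A>)" using \<phi> by (simp add: Aut_def)
      then have "tuple_action \<A> k \<phi> xs \<in> ?T"
        using Bij_imp_funcset[OF tuple_action_Bij] xs by blast
      then show ?thesis using R[OF \<phi> xs] xs fixed[OF \<phi>] by simp
    qed
    moreover have "?f \<in> ?T \<rightarrow>\<^sub>E carrier \<A>" using abA by auto
    ultimately show ?thesis
      using assms(1,3) unfolding automorphism_primal_def by blast
  qed
  \<comment> \<open>The constant function \<open>a\<close> is the indicator of the whole power.\<close>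
  obtain t where t: "is_term \<A> t" "vars t \<subseteq> {..<k}"
    "(\<lambda>xs\<in>?T. if xs \<in> UNIV then a else b) = (\<lambda>xs\<in>?T. term_value \<A> (\<lambda>i. xs ! i) t)"
    using ind[of UNIV] unfolding Clo_def by blast
  obtain t' where t': "is_term \<A> t'" "vars t' \<subseteq> {..<k}"
    "(\<lambda>xs\<in>?T. if xs \<in> S then a else b) = (\<lambda>xs\<in>?T. term_value \<A> (\<lambda>i. xs ! i) t')"
    using ind[of S] inv unfolding Clo_def by blast
  have "term_value \<A> (\<lambda>i. xs ! i) t = a"
    "term_value \<A> (\<lambda>i. xs ! i) t' = (if xs \<in> S then a else b)" if "xs \<in> ?T" for xs
    using fun_cong[OF t(3), of xs] fun_cong[OF t'(3), of xs] that by simp_all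
  then have "solutions \<A> k t t' = S"
    using S ab(3) by (auto simp: solutions_def split: if_splits)
  with t t' that show ?thesis by blast
qed

section \<open>The equational probabilistic spectrum\<close>

theorem theorem3p7:
  fixes \<A> :: "('f, 'a) algebra"
  assumes "finite_algebra \<A>"
    and "automorphism_primal \<A>"
    and "card (Fix \<A>) \<ge> 2"
  shows "PSpec \<A> =
    (\<Union>k\<in>{1..}. {1 / real (card (carrier \<A>)) ^ k * real (\<Sum>C\<in>I. card C) | I.
       I \<subseteq> tuple_orbits \<A> k})"
    (is "_ = ?R")
proof (intro equalityI subsetI)
  have fin: "finite (tuples (carrier \<A>) k)" for k
    by (rule finite_tuples) (use assms(1) in \<open>simp add: finite_algebra_def\<close>)
  have carrier_Aut: "carrier (Aut_group \<A>) = Aut \<A>"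
    by (simp add: Aut_group_def)
  {
    fix p assume "p \<in> PSpec \<A>"
    then obtain t t' where t: "is_term \<A> t" "is_term \<A> t'" and p: "p = eq_prob \<A> t t'"
      by (auto simp: PSpec_def)
    obtain m where "\<forall>i\<in>vars t \<union> vars t'. i \<le> m"
      using finite_nat_set_iff_bounded_le finite_vars by (metis finite_Un)
    then have V: "vars t \<union> vars t' \<subseteq> {..<Suc m}" by (auto simp: less_Suc_eq_le)
    interpret group_action "Aut_group \<A>" "tuples (carrier \<A>) (Suc m)" "tuple_action \<A> (Suc m)"
      by (rule group_action_tuples[OF assms(1)])
    obtain I where I: "I \<subseteq> tuple_orbits \<A> (Suc m)" "\<Union>I = solutions \<A> (Suc m) t t'"
    proof (rule invariant_Union_orbits)
      show "solutions \<A> (Suc m) t t' \<subseteq> tuples (carrier \<A>) (Suc m)"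
        by (auto simp: solutions_def)
    qed (use solutions_invariant[OF assms(1) t V] carrier_Aut in \<open>auto simp: tuple_orbits_def\<close>)
    have "p = 1 / real (card (carrier \<A>)) ^ Suc m * real (\<Sum>C\<in>I. card C)"
      using card_Union_orbits[OF fin I(1)[unfolded tuple_orbits_def]]
      by (simp add: p eq_prob_tuples[OF assms(1) V] I(2) del: power_Suc of_nat_sum)
    with I(1) have "p \<in> {1 / real (card (carrier \<A>)) ^ Suc m * real (\<Sum>C\<in>I. card C) | I.
        I \<subseteq> tuple_orbits \<A> (Suc m)}"
      by blast
    then show "p \<in> ?R" by (rule UN_I[rotated]) simp
  next
    fix p assume "p \<in> ?R"
    then obtain k I where k: "k \<ge> 1" and I: "I \<subseteq> tuple_orbits \<A> k"
      and p: "p = 1 / real (card (carrier \<A>)) ^ k * real (\<Sum>C\<in>I. card C)"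
      by auto
    interpret group_action "Aut_group \<A>" "tuples (carrier \<A>) k" "tuple_action \<A> k"
      by (rule group_action_tuples[OF assms(1)])
    note I' = I[unfolded tuple_orbits_def]
    obtain t t' where t: "is_term \<A> t" "is_term \<A> t'" and V: "vars t \<union> vars t' \<subseteq> {..<k}"
      and sol: "solutions \<A> k t t' = \<Union>I"
    proof (rule automorphism_primal_solutions[OF assms(2,3) k])
      show "\<Union>I \<subseteq> tuples (carrier \<A>) k" using I' orbits_coverture by blast
      show "tuple_action \<A> k \<phi> xs \<in> \<Union>I \<longleftrightarrow> xs \<in> \<Union>I"
        if "\<phi> \<in> Aut \<A>" "xs \<in> tuples (carrier \<A>) k" for \<phi> xs
        using mem_Union_orbits_iff[OF I'] that carrier_Aut by blast
    qed
    have "p = eq_prob \<A> t t'"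
      by (simp add: p eq_prob_tuples[OF assms(1) V] sol card_Union_orbits[OF fin I'])
    with t show "p \<in> PSpec \<A>" by (auto simp: PSpec_def)
  }
qed

end
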